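(* Let $\ell\ge2$ be an integer, $\ell_{\mathsf c}=\ell(\ell+1)/2$, $k\in\mathbb N$ (positive integer), and consider first-passage percolation on the $\ell$-spread-out line with i.i.d. nonnegative edge weights distributed as $\omega$. Assume that there is $a>0$ with $\mathbb P(\omega>2a)>0$ and $\mathbb P(\omega<a)>0$; fix such an $a$, let $\rho_1<\rho_2$ be the first two pivots in $[0,\infty)$, and let $\mathsf T_1=T(\rho_1,\rho_2)$. Say that $\omega$ satisfies the heavy-tail condition with index $\gamma$ if $\gamma\in(0,2)$ and $\mathbb P(\omega>x)=x^{-\gamma}L(x)$ as $x\to\infty$ for some slowly varying function $L$. (i) If the heavy-tail condition holds with $0<\gamma<k/\ell_{\mathsf c}$, then $\mathbb E\,\mathsf T_1^k=\infty$. (ii) If either the heavy-tail condition holds with $\gamma>k/\ell_{\mathsf c}$, or $\mathbb E\,\omega^k<\infty$, then $\mathbb E\,\mathsf T_1^k<\infty$.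
   Context: The $\ell$-spread-out line is the undirected graph on $\mathbb Z$ with edge set $\{(x,y):x,y\in\mathbb Z,\ 1\le y-x\le\ell\}$. Edges carry i.i.d. nonnegative weights $\omega_{x,y}=\omega_{y,x}$ with the law of $\omega$. The passage time $T(u,v)$ is the minimal total weight of a path from $u$ to $v$. A vertex $v$ is called a pivot if $\omega_{x,v}<a$, $\omega_{v,y}<a$ and $\omega_{x,y}>2a$ for all $x<v<y$ with $2\le y-x\le \ell$. Almost surely there are infinitely many pivots in $[0,\infty)$. *)

theory Defs
  imports "HOL-Probability.Probability"
begin

text \<open>Each undirected edge of the spread-out line is represented once, by the pair of its
  endpoints in increasing order.\<close>

definition spread_out_edges :: "nat \<Rightarrow> (int \<times> int) set" where
  "spread_out_edges l = {(x, y). 1 \<le> y - x \<and> y - x \<le> int l}"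

definition adjacent :: "nat \<Rightarrow> int \<Rightarrow> int \<Rightarrow> bool" where
  "adjacent l x y \<longleftrightarrow> (x, y) \<in> spread_out_edges l \<or> (y, x) \<in> spread_out_edges l"

definition paths :: "nat \<Rightarrow> int \<Rightarrow> int \<Rightarrow> int list set" where
  "paths l u v =
     {p. p \<noteq> [] \<and> hd p = u \<and> last p = v \<and> distinct p \<and> successively (adjacent l) p}"

definition path_weight :: "(int \<Rightarrow> int \<Rightarrow> real) \<Rightarrow> int list \<Rightarrow> real" where
  "path_weight w p = (\<Sum>(x, y)\<leftarrow>zip p (tl p). w x y)"

text \<open>The minimum over the infinitely many paths is written as an infimum. The set is nonempty
  for \<open>l \<ge> 1\<close>, and bounded below by \<open>0\<close> for nonnegative weights.\<close>

definition passage_time :: "nat \<Rightarrow> (int \<Rightarrow> int \<Rightarrow> real) \<Rightarrow> int \<Rightarrow> int \<Rightarrow> real" where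
  "passage_time l w u v = (INF p\<in>paths l u v. path_weight w p)"

definition pivot :: "nat \<Rightarrow> real \<Rightarrow> (int \<Rightarrow> int \<Rightarrow> real) \<Rightarrow> int \<Rightarrow> bool" where
  "pivot l a w v \<longleftrightarrow>
     (\<forall>x y. x < v \<and> v < y \<and> 2 \<le> y - x \<and> y - x \<le> int l \<longrightarrow>
        w x v < a \<and> w v y < a \<and> w x y > 2 * a)"

text \<open>The values below are meaningful only if there are at least two pivots in \<open>[0,\<infinity>)\<close>;
  under the assumptions on the weights this holds almost surely.\<close>

definition first_pivot :: "nat \<Rightarrow> real \<Rightarrow> (int \<Rightarrow> int \<Rightarrow> real) \<Rightarrow> int" where
  "first_pivot l a w = (LEAST v. 0 \<le> v \<and> pivot l a w v)"

definition second_pivot :: "nat \<Rightarrow> real \<Rightarrow> (int \<Rightarrow> int \<Rightarrow> real) \<Rightarrow> int" where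
  "second_pivot l a w = (LEAST v. first_pivot l a w < v \<and> pivot l a w v)"

definition pivot_passage_time :: "nat \<Rightarrow> real \<Rightarrow> (int \<Rightarrow> int \<Rightarrow> real) \<Rightarrow> real" where
  "pivot_passage_time l a w = passage_time l w (first_pivot l a w) (second_pivot l a w)"

definition slowly_varying :: "(real \<Rightarrow> real) \<Rightarrow> bool" where
  "slowly_varying L \<longleftrightarrow>
     (\<exists>X. L \<in> borel_measurable (restrict_space borel {X..}) \<and> (\<forall>x\<ge>X. L x > 0)) \<and>
     (\<forall>c>0. ((\<lambda>x. L (c * x) / L x) \<longlongrightarrow> 1) at_top)"

definition heavy_tail :: "'b measure \<Rightarrow> ('b \<Rightarrow> real) \<Rightarrow> real \<Rightarrow> bool" where
  "heavy_tail N \<omega> \<gamma> \<longleftrightarrow>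
     0 < \<gamma> \<and> \<gamma> < 2 \<and>
     (\<exists>L. slowly_varying L \<and>
        (\<forall>\<^sub>F x in at_top. \<P>(z in N. \<omega> z > x) = x powr (- \<gamma>) * L x))"

end

theory Submission
  imports Defs "HOL-Real_Asymp.Real_Asymp"
begin

text \<open>Both bounds rest on the fact that \<open>lc = l (l + 1) / 2\<close> is the number of edges across a
  cut between two consecutive vertices.

  If all edges across the cut between \<open>l - 1\<close> and \<open>l\<close> exceed \<open>x\<close>, and \<open>0\<close> and \<open>2 l - 1\<close> are pivots
  (a condition on other edges, of positive probability), then these are the first two pivots and
  the passage time between them is at least \<open>x\<close>. So \<open>P(T \<ge> x) \<ge> c P(\<omega> > x) ^ lc\<close>, which makes the
  \<open>k\<close>-th moment infinite if \<open>\<gamma> lc < k\<close>.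

  Conversely, the edges \<open>(x, x + d)\<close> with \<open>d \<le> l\<close> and \<open>x\<close> in a given residue class modulo \<open>d\<close> form
  a path, and these \<open>lc\<close> paths are edge-disjoint. A pivot is joined to each of them by a light edge.
  So a large passage time between pivots in \<open>[0, R]\<close> requires a heavy edge on each of the paths,
  which has probability at most \<open>((R + 1) P(\<omega> > t / (R + 1))) ^ lc\<close>. Two pivots lie in \<open>[0, R]\<close>
  except with probability exponentially small in \<open>R\<close>; taking \<open>R\<close> of order \<open>log t\<close> makes the
  \<open>k\<close>-th moment finite as soon as \<open>P(\<omega> > t) \<le> C t powr -\<beta>\<close> with \<open>\<beta> lc > k\<close>.\<close>

subsection \<open>Deterministic estimates\<close>

lemma path_weight_Cons_Cons:
  "path_weight w (x # y # p) = w x y + path_weight w (y # p)"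
  by (simp add: path_weight_def)

lemma path_weight_singleton: "path_weight w [x] = 0"
  by (simp add: path_weight_def)

section \<open>Paths in a fixed weight configuration\<close>

locale nonneg_weights =
  fixes l :: nat and w :: "int \<Rightarrow> int \<Rightarrow> real"
  assumes nonneg: "(x, y) \<in> spread_out_edges l \<Longrightarrow> 0 \<le> w x y"
    and sym: "(x, y) \<in> spread_out_edges l \<Longrightarrow> w y x = w x y"
begin

lemma adjacent_nonneg: "adjacent l x y \<Longrightarrow> 0 \<le> w x y"
  using nonneg sym unfolding adjacent_def by metis

lemma path_weight_nonneg: "successively (adjacent l) p \<Longrightarrow> 0 \<le> path_weight w p"
proof (induction p rule: induct_list012)
  case (3 x y p)
  then show ?case
    using adjacent_nonneg[of x y] by (simp add: path_weight_Cons_Cons)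
qed (simp_all add: path_weight_def)

text \<open>Some step of the path leads from below \<open>c\<close> to \<open>c\<close> or beyond.
  That step alone costs at least \<open>t\<close>, and the remaining steps cost at least
  zero.\<close>

lemma path_weight_ge_cut:
  assumes "successively (adjacent l) p" "p \<noteq> []" "hd p < c" "c \<le> last p"
    and cut: "\<And>x y. (x, y) \<in> spread_out_edges l \<Longrightarrow> x < c \<Longrightarrow> c \<le> y \<Longrightarrow> t \<le> w x y"
  shows "t \<le> path_weight w p"
  using assms(1-4)
proof (induction p rule: induct_list012)
  case (3 x y p)
  have adj: "adjacent l x y" and succ: "successively (adjacent l) (y # p)"
    using 3 by simp_all
  show ?case
  proof (cases "y < c")
    case True
    then have "t \<le> path_weight w (y # p)"
      using 3 by simp
    then show ?thesis
      using adjacent_nonneg[OF adj] by (simp add: path_weight_Cons_Cons)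
  next
    case False
    then have "(x, y) \<in> spread_out_edges l"
      using adj 3 by (auto simp: adjacent_def spread_out_edges_def)
    then have "t \<le> w x y"
      using cut False 3 by auto
    then show ?thesis
      using path_weight_nonneg[OF succ] by (simp add: path_weight_Cons_Cons)
  qed
qed simp_all

text \<open>Only steps to the right are allowed, so concatenation never repeats a vertex and the
  result is distinct, as \<open>paths\<close> demands. The slack in \<open>refl\<close> makes the
  cost an upper bound.\<close>

inductive reachable_within :: "int \<Rightarrow> int \<Rightarrow> real \<Rightarrow> bool" where
  refl: "0 \<le> c \<Longrightarrow> reachable_within u u c"
| step: "(x, y) \<in> spread_out_edges l \<Longrightarrow> w x y \<le> b \<Longrightarrow> reachable_within y v c \<Longrightarrow>
    reachable_within x v (b + c)"

lemma reachable_within_trans: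
  "reachable_within u v b \<Longrightarrow> reachable_within v x c \<Longrightarrow> reachable_within u x (b + c)"
proof (induction rule: reachable_within.induct)
  case (refl b u)
  \<comment> \<open>Monotonicity in the cost: the surplus is handed down to the final
    \<open>refl\<close>.\<close>
  have "reachable_within u x c' \<Longrightarrow> c' \<le> c'' \<Longrightarrow> reachable_within u x c''" for c' c'' u
  proof (induction arbitrary: c'' rule: reachable_within.induct)
    case (refl c u)
    then show ?case by (auto intro: reachable_within.refl)
  next
    case (step x y b v c)
    have "reachable_within x v (b + (c'' - b))"
      by (rule reachable_within.step[OF step(1,2) step.IH]) (use step in simp)
    then show ?case by simp
  qed
  then show ?case using refl by auto
next
  case (step x y b v c)
  then show ?case
    by (metis reachable_within.step add.assoc)
qed

lemma reachable_within_edge: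
  "(x, y) \<in> spread_out_edges l \<Longrightarrow> w x y \<le> c \<Longrightarrow> reachable_within x y c"
  using step[OF _ _ refl[of 0]] by force

lemma reachable_within_progression:
  assumes "1 \<le> d" "d \<le> int l" "\<And>i. i < m \<Longrightarrow> w (x + d * int i) (x + d * int i + d) \<le> t"
  shows "reachable_within x (x + d * int m) (real m * t)"
  using assms(3)
proof (induction m)
  case 0
  show ?case using refl by simp
next
  case (Suc m)
  have "reachable_within (x + d * int m) (x + d * int m + d) t"
    by (rule reachable_within_edge) (use assms Suc in \<open>auto simp: spread_out_edges_def\<close>)
  then have "reachable_within x (x + d * int m + d) (real m * t + t)"
    using reachable_within_trans Suc by auto
  then show ?case by (simp add: algebra_simps)
qed

lemma reachable_within_path:
  assumes "reachable_within u v c"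
  shows "\<exists>p\<in>paths l u v. sorted_wrt (<) p \<and> path_weight w p \<le> c"
  using assms
proof (induction rule: reachable_within.induct)
  case (refl c u)
  then show ?case
    by (intro bexI[of _ "[u]"]) (auto simp: paths_def path_weight_singleton)
next
  case (step x y b v c)
  then obtain p where p: "p \<in> paths l y v" "sorted_wrt (<) p" "path_weight w p \<le> c"
    by blast
  then obtain q where q: "p = y # q"
    by (cases p) (auto simp: paths_def)
  have "x < y" using step by (auto simp: spread_out_edges_def)
  then have "sorted_wrt (<) (x # p)"
    using p q by auto
  moreover have "x # p \<in> paths l x v"
    using p(1) \<open>sorted_wrt (<) (x # p)\<close> step(1) q
    by (auto simp: paths_def adjacent_def)
  moreover have "path_weight w (x # p) \<le> b + c"
    using p q step by (simp add: path_weight_Cons_Cons)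
  ultimately show ?case by blast
qed

lemma passage_time_le:
  assumes "reachable_within u v c"
  shows "passage_time l w u v \<le> c"
proof -
  obtain p where p: "p \<in> paths l u v" "path_weight w p \<le> c"
    using reachable_within_path[OF assms] by blast
  have "bdd_below (path_weight w ` paths l u v)"
    by (rule bdd_belowI2[of _ 0]) (auto simp: paths_def path_weight_nonneg)
  then have "passage_time l w u v \<le> path_weight w p"
    unfolding passage_time_def using p by (intro cINF_lower) auto
  then show ?thesis using p by simp
qed

lemma paths_nonempty:
  assumes "1 \<le> l" "u \<le> v"
  shows "paths l u v \<noteq> {}"
proof -
  define m where "m = nat (v - u)"
  \<comment> \<open>Only existence matters, so each step is bounded crudely by the sum of all
    absolute weights.\<close>
  have "reachable_within u (u + 1 * int m) (real m * (\<Sum>i<m. \<bar>w (u + int i) (u + int i + 1)\<bar>))"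
  proof (rule reachable_within_progression)
    fix i assume "i < m"
    then have "\<bar>w (u + int i) (u + int i + 1)\<bar> \<le> (\<Sum>i<m. \<bar>w (u + int i) (u + int i + 1)\<bar>)"
      by (intro member_le_sum) auto
    then show "w (u + 1 * int i) (u + 1 * int i + 1) \<le> (\<Sum>i<m. \<bar>w (u + int i) (u + int i + 1)\<bar>)"
      by simp
  qed (use assms in auto)
  moreover have "u + 1 * int m = v" using assms by (simp add: m_def)
  ultimately show ?thesis
    using reachable_within_path by fastforce
qed

lemma passage_time_nonneg:
  assumes "1 \<le> l" "u \<le> v"
  shows "0 \<le> passage_time l w u v"
  unfolding passage_time_def
  by (rule cINF_greatest[OF paths_nonempty[OF assms]]) (auto simp: paths_def path_weight_nonneg)

lemma passage_time_ge_cut: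
  assumes "1 \<le> l" "u < c" "c \<le> v"
    and "\<And>x y. (x, y) \<in> spread_out_edges l \<Longrightarrow> x < c \<Longrightarrow> c \<le> y \<Longrightarrow> t \<le> w x y"
  shows "t \<le> passage_time l w u v"
  unfolding passage_time_def
proof (rule cINF_greatest)
  show "paths l u v \<noteq> {}" using paths_nonempty assms by simp
  fix p assume "p \<in> paths l u v"
  then show "t \<le> path_weight w p"
    by (intro path_weight_ge_cut[OF _ _ _ _ assms(4)]) (use assms in \<open>auto simp: paths_def\<close>)
qed

text \<open>A pivot is joined by light edges to all vertices at distance less than \<open>l\<close>. Hence one can
  enter and leave any arithmetic progression of difference \<open>d \<le> l\<close> at cost \<open>2 * a\<close>.\<close>

lemma passage_time_between_pivots_le:
  assumes piv: "pivot l a w u" "pivot l a w v" and uv: "0 \<le> u" "u < v" "v \<le> int R"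
    and a: "0 \<le> a" and l: "2 \<le> l"
    and d: "1 \<le> d" "d \<le> int l" and r: "0 \<le> r" "r < d" and t: "0 \<le> t"
    and light: "\<And>x. 0 \<le> x \<Longrightarrow> x \<le> int R \<Longrightarrow> x mod d = r \<Longrightarrow> w x (x + d) \<le> t"
  shows "passage_time l w u v \<le> 2 * a + real R * t"
proof -
  \<comment> \<open>The pivot condition at \<open>u\<close> is applied with the auxiliary left
    vertex \<open>u - 1\<close>. The edge jumping over \<open>u\<close> then has length
    \<open>y - u + 1\<close>, hence the strict bound on \<open>y\<close>.\<close>
  have out: "reachable_within u y a" if "u \<le> y" "y < u + int l" for y
  proof (cases "y = u")
    case False
    then have "w u y < a"
      using piv(1)[unfolded pivot_def, rule_format, of "u - 1" y] that by auto
    then show ?thesis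
      using that False by (intro reachable_within_edge) (auto simp: spread_out_edges_def)
  qed (use refl a in auto)
  have into: "reachable_within x v a" if "x \<le> v" "v < x + int l" for x
  proof (cases "x = v")
    case False
    then have "w x v < a"
      using piv(2)[unfolded pivot_def, rule_format, of x "v + 1"] that by auto
    then show ?thesis
      using that False by (intro reachable_within_edge) (auto simp: spread_out_edges_def)
  qed (use refl a in auto)
  \<comment> \<open>The first point from \<open>u\<close> on, and the last point up to
    \<open>v\<close>, that is congruent to \<open>r\<close> modulo \<open>d\<close>.\<close>
  define x where "x = u + (r - u) mod d"
  define y where "y = v - (v - r) mod d"
  have x: "u \<le> x" "x < u + d" and y: "y \<le> v" "v < y + d"
    using d by (auto simp: x_def y_def)
  have "d dvd x - r" "d dvd y - r"
    by (simp_all add: x_def y_def mod_eq_dvd_iff[symmetric] mod_simps)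
  then have xr: "x mod d = r" and dvd: "d dvd y - x"
    using r dvd_diff[of d "y - r" "x - r"] by (simp_all add: mod_eq_dvd_iff[symmetric])
  have "\<exists>c. reachable_within u v c \<and> c \<le> 2 * a + real R * t"
  proof (cases "x \<le> y")
    \<comment> \<open>The class has no point between the pivots. Then
      \<open>v < y + d \<le> x < u + d\<close>, so a single light edge joins them.\<close>
    case False
    then have "d \<le> x - y"
      using dvd by (intro zdvd_imp_le) (auto simp: dvd_diff_commute)
    then have "v < u + int l"
      using x y d by linarith
    then show ?thesis
      using out[of v] uv a t by (intro exI[of _ a]) auto
  next
    case True
    obtain m' where m': "y - x = d * m'" using dvd by auto
    have "0 \<le> d * m'" using True m' by simp
    then have "0 \<le> m'" using d by (simp add: zero_le_mult_iff)
    define m where "m = nat m'"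
    have m: "y = x + d * int m"
      using m' \<open>0 \<le> m'\<close> by (simp add: m_def algebra_simps)
    have "reachable_within x (x + d * int m) (real m * t)"
    proof (rule reachable_within_progression[OF d])
      fix i assume "i < m"
      have le: "d * int i \<le> d * int m"
        using \<open>i < m\<close> d by (intro mult_left_mono) auto
      have "x + d * int i \<le> int R"
        using x uv y m by (intro order_trans[OF add_left_mono[OF le, of x]]) linarith
      moreover have "0 \<le> d * int i" using d by simp
      ultimately show "w (x + d * int i) (x + d * int i + d) \<le> t"
        using light[of "x + d * int i"] x(1) uv(1) xr by simp
    qed
    then have "reachable_within u v (a + real m * t + a)"
      using out[of x] into[of y] m x y d by (intro reachable_within_trans) auto
    moreover have "int m \<le> d * int m" using d by (simp add: mult_le_cancel_right1)
    then have "m \<le> R" using m x y uv by linarith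
    then have "real m * t \<le> real R * t" using t by (intro mult_right_mono) auto
    ultimately show ?thesis by (intro exI) auto
  qed
  then show ?thesis using passage_time_le by force
qed

end

section \<open>Existence and location of the first two pivots\<close>

lemma Least_int:
  fixes P :: "int \<Rightarrow> bool"
  assumes "P n" "\<And>m. P m \<Longrightarrow> b \<le> m"
  shows "P (LEAST m. P m)" "(LEAST m. P m) \<le> n"
proof -
  \<comment> \<open>The integers are not well-ordered; shifting by the lower bound \<open>b\<close>
    moves the minimum to \<open>nat\<close>.\<close>
  obtain m where m: "P m" "\<And>m'. P m' \<Longrightarrow> nat (m - b) \<le> nat (m' - b)"
    using ex_has_least_nat[of P n "\<lambda>m. nat (m - b)"] assms(1) by auto
  have le: "m \<le> m'" if "P m'" for m'
    using m(2)[OF that] assms(2)[OF that] assms(2)[OF m(1)] by linarith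
  have "(LEAST m. P m) = m" using m(1) le by (rule Least_equality)
  then show "P (LEAST m. P m)" "(LEAST m. P m) \<le> n"
    using m(1) le[OF assms(1)] by simp_all
qed

text \<open>Two known pivots ensure that both \<open>LEAST\<close> expressions are attained, and
  confine the random pivots to a deterministic window ending at \<open>v\<close>.\<close>

lemma first_second_pivot:
  assumes "0 \<le> u" "u < v" "pivot l a w u" "pivot l a w v"
  shows "pivot l a w (first_pivot l a w)" "pivot l a w (second_pivot l a w)"
    "0 \<le> first_pivot l a w" "first_pivot l a w < second_pivot l a w" "second_pivot l a w \<le> v"
proof -
  let ?P = "\<lambda>x. 0 \<le> x \<and> pivot l a w x"
  let ?Q = "\<lambda>x. first_pivot l a w < x \<and> pivot l a w x"
  have 1: "?P (first_pivot l a w)" "first_pivot l a w \<le> u"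
    unfolding first_pivot_def using Least_int[of ?P u 0] assms by auto
  have 2: "?Q (second_pivot l a w)" "second_pivot l a w \<le> v"
    unfolding second_pivot_def using Least_int[of ?Q v "first_pivot l a w"] assms 1 by auto
  show "pivot l a w (first_pivot l a w)" "pivot l a w (second_pivot l a w)"
    "0 \<le> first_pivot l a w" "first_pivot l a w < second_pivot l a w" "second_pivot l a w \<le> v"
    using 1 2 by auto
qed

lemma first_second_pivot_eq:
  assumes "0 \<le> u" "u < v" "pivot l a w u" "pivot l a w v"
    and "\<And>x. 0 \<le> x \<Longrightarrow> x < v \<Longrightarrow> x \<noteq> u \<Longrightarrow> \<not> pivot l a w x"
  shows "first_pivot l a w = u" "second_pivot l a w = v"
proof -
  note p = first_second_pivot[OF assms(1-4)]
  show "first_pivot l a w = u"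
    using p assms(5)[of "first_pivot l a w"] by linarith
  then show "second_pivot l a w = v"
    using p assms(5)[of "second_pivot l a w"] by fastforce
qed

subsection \<open>Tails and moments\<close>

lemma between_powers_of_two:
  fixes y :: real
  assumes "1 < y"
  shows "\<exists>n. 2 ^ n < y \<and> y \<le> 2 ^ Suc n"
proof -
  define n where "n = (LEAST n. y \<le> 2 ^ n)"
  have "\<exists>n. y \<le> 2 ^ n" using real_arch_pow[of 2 y] by (force intro: less_imp_le)
  then have n: "y \<le> 2 ^ n" unfolding n_def by (rule LeastI_ex)
  then obtain m where m: "n = Suc m" using assms by (cases n) auto
  then have "\<not> y \<le> 2 ^ m" using not_less_Least[of m "\<lambda>n. y \<le> 2 ^ n"] n_def by auto
  then show ?thesis using n m by (intro exI[of _ m]) auto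
qed

text \<open>The power contributes \<open>2 powr (- \<gamma>)\<close> and slow variation a factor
  tending to 1. Dilation by 2 suffices because all later estimates run along powers of two.\<close>

lemma slowly_varying_tail_ratio:
  assumes L: "slowly_varying L" and F: "\<forall>\<^sub>F x in at_top. F x = x powr (- \<gamma>) * L x"
  shows "((\<lambda>x. F (2 * x) / F x) \<longlongrightarrow> 2 powr (- \<gamma>)) at_top" "\<forall>\<^sub>F x in at_top. 0 < F x"
proof -
  have pos: "\<forall>\<^sub>F x in at_top. 0 < L x"
    using L unfolding slowly_varying_def eventually_at_top_linorder by blast
  show "\<forall>\<^sub>F x in at_top. 0 < F x"
    using F pos eventually_gt_at_top[of 0] by eventually_elim auto
  have F2: "\<forall>\<^sub>F x in at_top. F (2 * x) = (2 * x) powr (- \<gamma>) * L (2 * x)"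
    by (rule eventually_compose_filterlim[OF F]) real_asymp
  have "\<forall>\<^sub>F x in at_top. 2 powr (- \<gamma>) * (L (2 * x) / L x) = F (2 * x) / F x"
    using F F2 pos eventually_gt_at_top[of 0] by eventually_elim (simp add: powr_mult)
  moreover have "((\<lambda>x. 2 powr (- \<gamma>) * (L (2 * x) / L x)) \<longlongrightarrow> 2 powr (- \<gamma>) * 1) at_top"
    using L by (intro tendsto_mult tendsto_const) (auto simp: slowly_varying_def)
  ultimately show "((\<lambda>x. F (2 * x) / F x) \<longlongrightarrow> 2 powr (- \<gamma>)) at_top"
    using Lim_transform_eventually by fastforce
qed

text \<open>As \<beta> exceeds \<gamma>, doubling eventually costs at most a factor
  \<open>2 powr (- \<beta>)\<close>, and this iterates. The parameter \<open>b\<close> lets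
  \<open>x0\<close> be taken beyond a prescribed threshold.\<close>

lemma slowly_varying_tail_lower:
  assumes "slowly_varying L" "\<forall>\<^sub>F x in at_top. F x = x powr (- \<gamma>) * L x" and "\<gamma> < \<beta>"
  obtains x0 where "b \<le> x0" "0 < x0" "0 < F x0" "\<And>n. (2 powr (- \<beta>)) ^ n * F x0 \<le> F (2 ^ n * x0)"
proof -
  note ratio = slowly_varying_tail_ratio[OF assms(1,2)]
  have "\<forall>\<^sub>F x in at_top. 2 powr (- \<beta>) < F (2 * x) / F x"
    using ratio(1) by (rule order_tendstoD) (use assms(3) in simp)
  then have "\<forall>\<^sub>F x in at_top. 2 powr (- \<beta>) * F x \<le> F (2 * x) \<and> 0 < F x \<and> b \<le> x \<and> 0 < x"
    using ratio(2) eventually_ge_at_top[of b] eventually_gt_at_top[of 0]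
    by eventually_elim (auto simp: field_simps)
  then obtain x0 where x0: "\<And>x. x0 \<le> x \<Longrightarrow> 2 powr (- \<beta>) * F x \<le> F (2 * x) \<and> 0 < F x \<and> b \<le> x \<and> 0 < x"
    by (auto simp: eventually_at_top_linorder)
  have "(2 powr (- \<beta>)) ^ n * F x0 \<le> F (2 ^ n * x0)" for n
  proof (induction n)
    case (Suc n)
    have "2 powr (- \<beta>) * ((2 powr (- \<beta>)) ^ n * F x0) \<le> 2 powr (- \<beta>) * F (2 ^ n * x0)"
      using Suc by (intro mult_left_mono) auto
    also have "\<dots> \<le> F (2 * (2 ^ n * x0))"
      using x0[of "2 ^ n * x0"] x0[of x0] by (auto simp: mult_le_cancel_right1)
    finally show ?case by (simp add: mult.assoc)
  qed simp
  then show thesis using that x0[of x0] by auto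
qed

text \<open>With \<beta> below \<gamma> the doubling estimate iterates in the other direction.
  Monotonicity fills the gaps between dyadic points, and the bound 1 handles small
  \<open>t\<close>.\<close>

lemma slowly_varying_tail_upper:
  assumes "slowly_varying L" "\<forall>\<^sub>F x in at_top. F x = x powr (- \<gamma>) * L x" and "0 < \<beta>" "\<beta> < \<gamma>"
    and "antimono F" and F_le_1: "\<And>x. F x \<le> (1::real)"
  shows "\<exists>C>0. \<forall>t>0. F t \<le> C * t powr (- \<beta>)"
proof -
  note ratio = slowly_varying_tail_ratio[OF assms(1,2)]
  have "\<forall>\<^sub>F x in at_top. F (2 * x) / F x < 2 powr (- \<beta>)"
    using ratio(1) by (rule order_tendstoD) (use assms(4) in simp)
  then have "\<forall>\<^sub>F x in at_top. F (2 * x) \<le> 2 powr (- \<beta>) * F x \<and> 0 < x"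
    using ratio(2) eventually_gt_at_top[of 0]
    by eventually_elim (auto simp: field_simps)
  then obtain x0 where x0: "\<And>x. x0 \<le> x \<Longrightarrow> F (2 * x) \<le> 2 powr (- \<beta>) * F x \<and> 0 < x"
    by (auto simp: eventually_at_top_linorder)
  have "0 < x0" using x0 by blast
  have dyadic: "F (2 ^ n * x0) \<le> (2 powr (- \<beta>)) ^ n" for n
  proof (induction n)
    case (Suc n)
    have "F (2 * (2 ^ n * x0)) \<le> 2 powr (- \<beta>) * F (2 ^ n * x0)"
      using x0[of "2 ^ n * x0"] \<open>0 < x0\<close> by (auto simp: mult_le_cancel_right1)
    also have "\<dots> \<le> 2 powr (- \<beta>) * (2 powr (- \<beta>)) ^ n"
      using Suc by (intro mult_left_mono) auto
    finally show ?case by (simp add: mult.assoc)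
  qed (use F_le_1 in simp)
  \<comment> \<open>The 2 in the constant pays for rounding \<open>t / x0\<close> down to a power of
    two. For \<open>t \<le> x0\<close> the right-hand side is at least 1.\<close>
  have "F t \<le> (2 * x0) powr \<beta> * t powr (- \<beta>)" if "0 < t" for t
  proof (cases "t \<le> x0")
    case True
    have "t powr \<beta> \<le> (2 * x0) powr \<beta>"
      using that True assms(3) by (intro powr_mono2) auto
    then have "1 \<le> (2 * x0) powr \<beta> * t powr (- \<beta>)"
      using that by (simp add: powr_minus field_simps)
    then show ?thesis using F_le_1[of t] by linarith
  next
    case False
    then obtain n where n: "2 ^ n < t / x0" "t / x0 \<le> 2 ^ Suc n"
      using between_powers_of_two[of "t / x0"] \<open>0 < x0\<close> by (auto simp: field_simps)
    have "F t \<le> F (2 ^ n * x0)"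
      by (rule antimonoD[OF assms(5)]) (use n(1) \<open>0 < x0\<close> in \<open>simp add: pos_less_divide_eq\<close>)
    also have "\<dots> \<le> (2 ^ n) powr (- \<beta>)"
      using dyadic[of n] powr_powr[of 2 "- \<beta>" "real n"] powr_powr[of 2 "real n" "- \<beta>"]
      by (simp add: powr_realpow mult.commute)
    also have "\<dots> \<le> (t / (2 * x0)) powr (- \<beta>)"
    proof (rule powr_mono2')
      show "t / (2 * x0) \<le> 2 ^ n" using n(2) by simp
    qed (use assms(3) \<open>0 < x0\<close> that in auto)
    also have "\<dots> = (2 * x0) powr \<beta> * t powr (- \<beta>)"
      using \<open>0 < x0\<close> that by (subst powr_divide) (simp_all add: powr_minus divide_inverse mult.commute)
    finally show ?thesis .
  qed
  then show ?thesis using \<open>0 < x0\<close> by (intro exI[of _ "(2 * x0) powr \<beta>"]) auto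
qed

text \<open>Markov's inequality for the \<open>k\<close>-th power; adding 1 to the moment makes the
  constant positive.\<close>

lemma moment_tail_upper:
  fixes \<omega> :: "'b \<Rightarrow> real"
  assumes N: "prob_space N" and meas: "\<omega> \<in> borel_measurable N"
    and fin: "(\<integral>\<^sup>+ z. ennreal (\<omega> z ^ k) \<partial>N) < \<infinity>"
  shows "\<exists>C>0. \<forall>t>0. \<P>(z in N. \<omega> z > t) \<le> C * t powr (- real k)"
proof -
  interpret N: prob_space N by (rule N)
  define C where "C = enn2real (\<integral>\<^sup>+ z. ennreal (\<omega> z ^ k) \<partial>N)"
  have "\<P>(z in N. \<omega> z > t) \<le> (C + 1) * t powr (- real k)" if "0 < t" for t
  proof -
    let ?A = "{z \<in> space N. \<omega> z > t}"
    have A: "?A \<in> sets N" using meas by measurable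
    have "ennreal (t ^ k * N.prob ?A) = (\<integral>\<^sup>+ z. ennreal (t ^ k) * indicator ?A z \<partial>N)"
      using A that by (simp add: nn_integral_cmult_indicator ennreal_mult N.emeasure_eq_measure)
    also have "\<dots> \<le> (\<integral>\<^sup>+ z. ennreal (\<omega> z ^ k) \<partial>N)"
      using that by (intro nn_integral_mono) (auto split: split_indicator intro!: ennreal_leI power_mono)
    also have "\<dots> = ennreal C"
      using fin by (simp add: C_def)
    finally have "t ^ k * N.prob ?A \<le> C + 1"
      by (simp add: C_def)
    then show ?thesis
      using that by (simp add: powr_minus powr_realpow field_simps)
  qed
  then show ?thesis
    by (intro exI[of _ "C + 1"]) (auto simp: C_def add_nonneg_pos)
qed

section \<open>Moments from probabilities at dyadic scales\<close>

lemma summable_powr_times_geometric: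
  fixes A p q :: real
  assumes "0 < A" "0 < q" "q < 1"
  shows "summable (\<lambda>i. (A * real i + 1) powr p * q ^ i)"
proof -
  have "(\<lambda>i. (A * real i + 1) powr p * q ^ i) \<in> O(\<lambda>i. 1 / real i ^ 2)"
    using assms by real_asymp
  moreover have "summable (\<lambda>i. norm (1 / real i ^ 2))"
    using inverse_power_summable[of 2, where 'a = real] by (simp add: field_simps)
  ultimately show ?thesis
    by (rule summable_comparison_test_bigo[rotated])
qed

text \<open>If \<open>b * 2 ^ i < \<bar>f z\<bar> \<le> b * 2 ^ Suc i\<close>, then \<open>z\<close>
  lies in \<open>E i\<close> and the power is at most \<open>b ^ k * 2 ^ (Suc i * k)\<close>.
  Covering events take the place of level sets, so measurability is asked of \<open>E i\<close>
  only, while \<open>f\<close> will be built from \<open>LEAST\<close> and an infimum.\<close>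

lemma (in prob_space) moment_finite_dyadic:
  fixes f :: "'a \<Rightarrow> real"
  assumes E: "\<And>i. E i \<in> events" and cover: "AE z in M. \<forall>i. b * 2 ^ i < \<bar>f z\<bar> \<longrightarrow> z \<in> E i" and b: "0 < b"
    and sum: "summable (\<lambda>i. 2 ^ (i * k) * prob (E i))"
  shows "(\<integral>\<^sup>+ z. ennreal (f z ^ k) \<partial>M) < \<infinity>"
proof -
  let ?g = "\<lambda>i z. ennreal (2 ^ (Suc i * k)) * indicator (E i) z"
  have bound: "AE z in M. ennreal (f z ^ k) \<le> ennreal (b ^ k) * (1 + (\<Sum>i. ?g i z))"
    using cover
  proof eventually_elim
    case (elim z)
    have pow: "f z ^ k \<le> \<bar>f z\<bar> ^ k" by (metis abs_ge_self power_abs)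
    show ?case
    proof (cases "\<bar>f z\<bar> \<le> b")
      case True
      then have "\<bar>f z\<bar> ^ k \<le> b ^ k" by (intro power_mono) auto
      then have "ennreal (f z ^ k) \<le> ennreal (b ^ k) * 1"
        using pow by (auto intro: ennreal_leI)
      also have "\<dots> \<le> ennreal (b ^ k) * (1 + (\<Sum>i. ?g i z))"
        by (intro mult_left_mono) auto
      finally show ?thesis .
    next
      case False
      then obtain i where i: "2 ^ i < \<bar>f z\<bar> / b" "\<bar>f z\<bar> / b \<le> 2 ^ Suc i"
        using between_powers_of_two[of "\<bar>f z\<bar> / b"] b by auto
      then have z: "z \<in> E i" using elim b by (auto simp: field_simps)
      have "\<bar>f z\<bar> ^ k \<le> (b * 2 ^ Suc i) ^ k"
        using i(2) b by (intro power_mono) (auto simp: field_simps)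
      then have "ennreal (f z ^ k) \<le> ennreal (b ^ k * 2 ^ (Suc i * k))"
        using pow by (intro ennreal_leI) (simp add: power_mult_distrib power_mult power_add)
      also have "\<dots> = ennreal (b ^ k) * ?g i z"
        using z b by (subst ennreal_mult) auto
      also have "?g i z \<le> (\<Sum>i. ?g i z)"
        using sum_le_suminf[of "\<lambda>i. ?g i z" "{i}"] by (simp del: sum_mult_indicator power_Suc mult_Suc)
      also have "\<dots> \<le> 1 + (\<Sum>i. ?g i z)" by simp
      finally show ?thesis by (simp add: mult_left_mono)
    qed
  qed
  have "(\<integral>\<^sup>+ z. (\<Sum>i. ?g i z) \<partial>M) = (\<Sum>i. \<integral>\<^sup>+ z. ?g i z \<partial>M)"
    using E by (intro nn_integral_suminf) auto
  also have "\<dots> = (\<Sum>i. ennreal (2 ^ k * (2 ^ (i * k) * prob (E i))))"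
    using E by (intro suminf_cong)
      (simp add: nn_integral_cmult_indicator emeasure_eq_measure ennreal_mult[symmetric] power_add)
  also have "\<dots> = ennreal (\<Sum>i. 2 ^ k * (2 ^ (i * k) * prob (E i)))"
    using sum by (intro suminf_ennreal2) (auto intro: summable_mult)
  finally have fin: "(\<integral>\<^sup>+ z. (\<Sum>i. ?g i z) \<partial>M) < \<infinity>" by simp
  have "(\<integral>\<^sup>+ z. ennreal (f z ^ k) \<partial>M) \<le> (\<integral>\<^sup>+ z. ennreal (b ^ k) * (1 + (\<Sum>i. ?g i z)) \<partial>M)"
    by (rule nn_integral_mono_AE[OF bound])
  also have "\<dots> = ennreal (b ^ k) * (1 + (\<integral>\<^sup>+ z. (\<Sum>i. ?g i z) \<partial>M))"
    using E by (simp add: nn_integral_cmult nn_integral_add emeasure_space_1)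
  also have "\<dots> < \<infinity>"
    using fin by (simp add: ennreal_mult_less_top)
  finally show ?thesis .
qed

subsection \<open>Events depending on finitely many edges\<close>

text \<open>The edges on which the pivot property of \<open>v\<close> depends. An edge ending at
  \<open>v\<close> is shorter than \<open>l\<close>, since the jump over \<open>v\<close> extending
  it by one vertex must still have length at most \<open>l\<close>.\<close>

definition pivot_edges :: "nat \<Rightarrow> int \<Rightarrow> (int \<times> int) set" where
  "pivot_edges l v =
     {(x, y) \<in> spread_out_edges l. x \<le> v \<and> v \<le> y \<and> (x = v \<or> y = v \<longrightarrow> y - x < int l)}"

definition pivot_range :: "real \<Rightarrow> int \<Rightarrow> int \<times> int \<Rightarrow> real set" where
  "pivot_range a v e = (if v = fst e \<or> v = snd e then {..<a} else {2 * a<..})"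

lemma pivot_edges_bounds:
  "(x, y) \<in> pivot_edges l v \<Longrightarrow> v - int l < x \<and> x \<le> v \<and> v \<le> y \<and> y < v + int l"
  by (auto simp: pivot_edges_def spread_out_edges_def split: if_splits)

lemma finite_pivot_edges: "finite (pivot_edges l v)"
  by (rule finite_subset[of _ "{v - int l..v + int l} \<times> {v - int l..v + int l}"])
    (auto dest: pivot_edges_bounds)

text \<open>The edges for \<open>v\<close> live in a window of \<open>2 * l - 1\<close> vertices
  around \<open>v\<close>, so at this distance the windows are disjoint.\<close>

lemma pivot_edges_disjoint:
  assumes "\<bar>u - v\<bar> \<ge> 2 * int l - 1"
  shows "pivot_edges l u \<inter> pivot_edges l v = {}"
  using assms by (force dest: pivot_edges_bounds)

text \<open>For an edge ending at \<open>v\<close>, the neighbour \<open>v - 1\<close> or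
  \<open>v + 1\<close> on the other side supplies the second endpoint in the definition of a
  pivot.\<close>

lemma pivot_iff:
  assumes "2 \<le> l"
  shows "pivot l a w v \<longleftrightarrow> (\<forall>(x, y)\<in>pivot_edges l v. w x y \<in> pivot_range a v (x, y))"
proof (intro iffI ballI, clarify)
  fix x y assume p: "pivot l a w v" and e: "(x, y) \<in> pivot_edges l v"
  note p' = p[unfolded pivot_def, rule_format]
  consider "x = v" | "y = v" | "x < v" "v < y"
    using pivot_edges_bounds[OF e] by linarith
  then show "w x y \<in> pivot_range a v (x, y)"
  proof cases
    case 1
    then show ?thesis
      using p'[of "v - 1" y] e by (auto simp: pivot_edges_def spread_out_edges_def pivot_range_def)
  next
    case 2
    then show ?thesis
      using p'[of x "v + 1"] e by (auto simp: pivot_edges_def spread_out_edges_def pivot_range_def)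
  next
    case 3
    then show ?thesis
      using p'[of x y] e by (auto simp: pivot_edges_def spread_out_edges_def pivot_range_def)
  qed
next
  assume *: "\<forall>(x, y)\<in>pivot_edges l v. w x y \<in> pivot_range a v (x, y)"
  have "w x v < a \<and> w v y < a \<and> w x y > 2 * a" 
    if "x < v" "v < y" "2 \<le> y - x" "y - x \<le> int l" for x y
  proof -
    have "(x, v) \<in> pivot_edges l v" "(v, y) \<in> pivot_edges l v" "(x, y) \<in> pivot_edges l v"
      using that by (auto simp: pivot_edges_def spread_out_edges_def)
    then show ?thesis
      using * that by (fastforce simp: pivot_range_def)
  qed
  then show "pivot l a w v" by (auto simp: pivot_def)
qed

lemma bij_betw_pivot_edges:
  "bij_betw (\<lambda>(x, y). (x + v, y + v)) (pivot_edges l 0) (pivot_edges l v)"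
  by (rule bij_betwI[where g = "\<lambda>(x, y). (x - v, y - v)"])
    (auto simp: pivot_edges_def spread_out_edges_def)

section \<open>Independent weights and product formulas\<close>

locale iid_line = prob_space M
  for M :: "'a measure" +
  fixes l :: nat and W :: "'a \<Rightarrow> int \<Rightarrow> int \<Rightarrow> real" and D :: "real measure"
  assumes indep: "indep_vars (\<lambda>_. borel) (\<lambda>(x, y) z. W z x y) (spread_out_edges l)"
    and law: "(x, y) \<in> spread_out_edges l \<Longrightarrow> distr M borel (\<lambda>z. W z x y) = D"
    and sym: "(x, y) \<in> spread_out_edges l \<Longrightarrow> z \<in> space M \<Longrightarrow> W z y x = W z x y"
    and AE_nonneg: "AE t in D. 0 \<le> t"
    and l: "2 \<le> l"
begin

lemma weight_measurable: "(x, y) \<in> spread_out_edges l \<Longrightarrow> (\<lambda>z. W z x y) \<in> borel_measurable M"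
  using indep unfolding indep_vars_def by force

lemma D_eq: "D = distr M borel (\<lambda>z. W z 0 1)"
  using l by (intro law[symmetric]) (auto simp: spread_out_edges_def)

lemma sets_D [measurable_cong, simp]: "sets D = sets borel" "space D = UNIV"
  by (simp_all add: D_eq)

sublocale D: prob_space D
  unfolding D_eq by (rule prob_space_distr, rule weight_measurable)
    (use l in \<open>auto simp: spread_out_edges_def\<close>)

lemma AE_nonneg_weights: "AE z in M. nonneg_weights l (W z)"
proof -
  have "AE z in M. \<forall>e\<in>spread_out_edges l. 0 \<le> W z (fst e) (snd e)"
  proof (rule AE_ball_countable')
    fix e assume "e \<in> spread_out_edges l"
    then have e: "(fst e, snd e) \<in> spread_out_edges l" by simp
    have "AE t in distr M borel (\<lambda>z. W z (fst e) (snd e)). 0 \<le> t"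
      unfolding law[OF e] by (rule AE_nonneg)
    then show "AE z in M. 0 \<le> W z (fst e) (snd e)"
      using weight_measurable[OF e] by (simp add: AE_distr_iff)
  qed simp
  then show ?thesis
    using AE_space by eventually_elim (auto simp: nonneg_weights_def sym)
qed

definition pattern :: "(int \<times> int) set \<Rightarrow> (int \<times> int \<Rightarrow> real set) \<Rightarrow> 'a set" where
  "pattern K S = {z \<in> space M. \<forall>(x, y)\<in>K. W z x y \<in> S (x, y)}"

lemma
  assumes K: "finite K" "K \<subseteq> spread_out_edges l" and S: "\<And>e. e \<in> K \<Longrightarrow> S e \<in> sets borel"
  shows sets_pattern: "pattern K S \<in> events"
    and prob_pattern: "prob (pattern K S) = (\<Prod>e\<in>K. measure D (S e))"
proof -
  have meas: "case_prod (\<lambda>x y z. W z x y) e -` S e \<inter> space M \<in> events" if "e \<in> K" for e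
    using that K S weight_measurable[of "fst e" "snd e"]
    by (cases e) (auto intro!: measurable_sets)
  \<comment> \<open>The empty case is separate: an empty intersection would be \<open>UNIV\<close>,
    and \<open>indep_varsD\<close> wants a nonempty index set.\<close>
  have eq: "pattern K S = (if K = {} then space M else
      (\<Inter>e\<in>K. case_prod (\<lambda>x y z. W z x y) e -` S e \<inter> space M))"
    by (auto simp: pattern_def)
  show "pattern K S \<in> events"
    unfolding eq using sets.finite_INT[OF K(1) _ meas] by auto
  show "prob (pattern K S) = (\<Prod>e\<in>K. measure D (S e))"
  proof (cases "K = {}")
    case True
    then show ?thesis by (simp add: pattern_def prob_space)
  next
    case False
    have "prob (pattern K S) = (\<Prod>e\<in>K. prob (case_prod (\<lambda>x y z. W z x y) e -` S e \<inter> space M))"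
      unfolding eq if_not_P[OF False] by (rule indep_varsD[OF indep False K(1,2)]) (rule S)
    also have "\<dots> = (\<Prod>e\<in>K. measure D (S e))"
    proof (rule prod.cong[OF HOL.refl])
      fix e assume "e \<in> K"
      then obtain x y where e: "e = (x, y)" "(x, y) \<in> spread_out_edges l"
        using K by (cases e) auto
      show "prob (case_prod (\<lambda>x y z. W z x y) e -` S e \<inter> space M) = measure D (S e)"
        using measure_distr[OF weight_measurable[OF e(2)], of "S e"] law[OF e(2)] e S \<open>e \<in> K\<close>
        by simp
    qed
    finally show ?thesis .
  qed
qed

definition pivot_prob :: "real \<Rightarrow> real" where
  "pivot_prob a = (\<Prod>e\<in>pivot_edges l 0. measure D (pivot_range a 0 e))"

lemma pivot_range_borel [simp]: "pivot_range a v e \<in> sets borel"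
  by (simp add: pivot_range_def)

lemma pivot_prob_eq: "(\<Prod>e\<in>pivot_edges l v. measure D (pivot_range a v e)) = pivot_prob a"
  unfolding pivot_prob_def
  by (subst prod.reindex_bij_betw[OF bij_betw_pivot_edges, symmetric])
    (auto intro!: prod.cong simp: pivot_range_def)

lemma pivot_prob_pos:
  assumes "0 < measure D {..<a}" "0 < measure D {2 * a<..}"
  shows "0 < pivot_prob a"
  unfolding pivot_prob_def using assms by (intro prod_pos) (auto simp: pivot_range_def)

lemma pivots_pattern:
  assumes V: "finite V" "\<And>u v. u \<in> V \<Longrightarrow> v \<in> V \<Longrightarrow> u \<noteq> v \<Longrightarrow> \<bar>u - v\<bar> \<ge> 2 * int l - 1"
  obtains S where "pattern (\<Union>v\<in>V. pivot_edges l v) S = {z \<in> space M. \<forall>v\<in>V. pivot l a (W z) v}"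
    "\<And>e. S e \<in> sets borel"
    "(\<Prod>e\<in>(\<Union>v\<in>V. pivot_edges l v). measure D (S e)) = pivot_prob a ^ card V"
proof -
  \<comment> \<open>The separation of \<open>V\<close> gives each edge of the union a unique pivot
    to serve, so one pattern encodes all the pivot conditions.\<close>
  define S where "S e = pivot_range a (THE v. v \<in> V \<and> e \<in> pivot_edges l v) e" for e
  have S: "S e = pivot_range a v e" if "v \<in> V" "e \<in> pivot_edges l v" for v e
  proof -
    have uniq: "u = v" if "u \<in> V" "e \<in> pivot_edges l u" for u
      using pivot_edges_disjoint[OF V(2)[OF \<open>u \<in> V\<close> \<open>v \<in> V\<close>]] that \<open>e \<in> pivot_edges l v\<close>
      by auto
    have "(THE v. v \<in> V \<and> e \<in> pivot_edges l v) = v"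
      by (rule the_equality) (use that in simp, use uniq in metis)
    then show ?thesis by (simp add: S_def)
  qed
  have pivot_iff': "pivot l a (W z) v \<longleftrightarrow> (\<forall>(x, y)\<in>pivot_edges l v. W z x y \<in> S (x, y))"
    if "v \<in> V" for v z
    unfolding pivot_iff[OF l] by (rule ball_cong) (use S[OF that] in auto)
  show thesis
  proof
    show "pattern (\<Union>v\<in>V. pivot_edges l v) S = {z \<in> space M. \<forall>v\<in>V. pivot l a (W z) v}"
      by (simp add: pattern_def pivot_iff')
    show "S e \<in> sets borel" for e by (simp add: S_def)
    have "(\<Prod>e\<in>(\<Union>v\<in>V. pivot_edges l v). measure D (S e)) =
        (\<Prod>v\<in>V. \<Prod>e\<in>pivot_edges l v. measure D (S e))"
      by (rule prod.UNION_disjoint)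
        (use V finite_pivot_edges pivot_edges_disjoint in auto)
    also have "\<dots> = (\<Prod>v\<in>V. pivot_prob a)"
      by (rule prod.cong) (use S pivot_prob_eq in auto)
    finally show "(\<Prod>e\<in>(\<Union>v\<in>V. pivot_edges l v). measure D (S e)) = pivot_prob a ^ card V"
      by simp
  qed
qed

lemma
  assumes V: "finite V" "\<And>u v. u \<in> V \<Longrightarrow> v \<in> V \<Longrightarrow> u \<noteq> v \<Longrightarrow> \<bar>u - v\<bar> \<ge> 2 * int l - 1"
  shows sets_pivots: "{z \<in> space M. \<forall>v\<in>V. pivot l a (W z) v} \<in> events"
    and prob_pivots: "prob {z \<in> space M. \<forall>v\<in>V. pivot l a (W z) v} = pivot_prob a ^ card V"
proof -
  obtain S where S: "pattern (\<Union>v\<in>V. pivot_edges l v) S = {z \<in> space M. \<forall>v\<in>V. pivot l a (W z) v}"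
    "\<And>e. S e \<in> sets borel"
    "(\<Prod>e\<in>(\<Union>v\<in>V. pivot_edges l v). measure D (S e)) = pivot_prob a ^ card V"
    using pivots_pattern[OF assms, of a] by blast
  have K: "finite (\<Union>v\<in>V. pivot_edges l v)" "(\<Union>v\<in>V. pivot_edges l v) \<subseteq> spread_out_edges l"
    using V finite_pivot_edges by (auto simp: pivot_edges_def)
  show "{z \<in> space M. \<forall>v\<in>V. pivot l a (W z) v} \<in> events"
    unfolding S(1)[symmetric] by (rule sets_pattern[OF K S(2)])
  show "prob {z \<in> space M. \<forall>v\<in>V. pivot l a (W z) v} = pivot_prob a ^ card V"
    unfolding S(1)[symmetric] S(3)[symmetric] by (rule prob_pattern[OF K S(2)])
qed

text \<open>Candidate pivots are placed at the multiples of \<open>2 * l\<close>, far enough apart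
  to use disjoint edges, and grouped in consecutive pairs.\<close>

definition pivot_pair :: "real \<Rightarrow> nat \<Rightarrow> 'a set" where
  "pivot_pair a j = {z \<in> space M. pivot l a (W z) (4 * int l * int j) \<and>
                                 pivot l a (W z) (4 * int l * int j + 2 * int l)}"

lemma
  assumes "finite J"
  shows sets_pivot_pairs: "{z \<in> space M. \<forall>j\<in>J. z \<in> pivot_pair a j} \<in> events"
    and prob_pivot_pairs: "prob {z \<in> space M. \<forall>j\<in>J. z \<in> pivot_pair a j} = (pivot_prob a ^ 2) ^ card J"
proof -
  define h where "h n = 2 * int l * int n" for n
  \<comment> \<open>Pair \<open>j\<close> occupies the positions \<open>h (2 * j)\<close> and
    \<open>h (2 * j + 1)\<close>.\<close>
  define U where "U = (\<lambda>j. 2 * j) ` J \<union> (\<lambda>j. 2 * j + 1) ` J"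
  have inj: "inj_on h U" for U
    using l by (auto simp: h_def inj_on_def)
  have far: "\<bar>u - v\<bar> \<ge> 2 * int l - 1" if uv: "u \<in> h ` U" "v \<in> h ` U" "u \<noteq> v" for u v
  proof -
    obtain m n where mn: "u = h m" "v = h n" "int m - int n \<noteq> 0" using uv by auto
    have "2 * int l * 1 \<le> 2 * int l * \<bar>int m - int n\<bar>"
      using mn(3) by (intro mult_left_mono) auto
    also have "\<dots> = \<bar>u - v\<bar>"
      by (simp add: mn h_def abs_mult flip: right_diff_distrib)
    finally show ?thesis by simp
  qed
  have "card U = card ((\<lambda>j. 2 * j) ` J) + card ((\<lambda>j. 2 * j + 1) ` J)"
    unfolding U_def using assms by (intro card_Un_disjoint) (auto, presburger)
  also have "\<dots> = 2 * card J"
    by (subst (1 2) card_image) (auto simp: inj_on_def)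
  finally have card: "card (h ` U) = 2 * card J"
    by (simp add: card_image[OF inj])
  have eq: "{z \<in> space M. \<forall>j\<in>J. z \<in> pivot_pair a j} = {z \<in> space M. \<forall>v\<in>h ` U. pivot l a (W z) v}"
    by (simp add: pivot_pair_def h_def U_def ball_Un ball_conj_distrib algebra_simps)
      (auto simp: mult.assoc mult.left_commute)
  have fin: "finite (h ` U)" using assms by (auto simp: U_def)
  show "{z \<in> space M. \<forall>j\<in>J. z \<in> pivot_pair a j} \<in> events"
    unfolding eq by (rule sets_pivots[OF fin far])
  show "prob {z \<in> space M. \<forall>j\<in>J. z \<in> pivot_pair a j} = (pivot_prob a ^ 2) ^ card J"
    unfolding eq by (subst prob_pivots[OF fin far]) (simp_all add: card power_mult)
qed

lemma sets_pivot_pair: "pivot_pair a j \<in> events"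
  using sets_pivot_pairs[of "{j}" a] by (simp add: pivot_pair_def conj_commute cong: conj_cong)

text \<open>Only probabilities of joint occurrence are known. Induction on the number of excluded
  pairs, with a set \<open>J\<close> of later pairs required to occur, reduces exclusion to a
  difference of two such probabilities.\<close>

lemma prob_no_pivot_pair:
  "prob {z \<in> space M. \<forall>j<n. z \<notin> pivot_pair a j} = (1 - pivot_prob a ^ 2) ^ n"
proof -
  have "prob {z \<in> space M. (\<forall>j<m. z \<notin> pivot_pair a j) \<and> (\<forall>j\<in>J. z \<in> pivot_pair a j)} =
      (1 - pivot_prob a ^ 2) ^ m * (pivot_prob a ^ 2) ^ card J"
    if "finite J" "\<forall>j\<in>J. m \<le> j" for m J
    using that
  proof (induction m arbitrary: J)
    case 0
    then show ?case using prob_pivot_pairs by simp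
  next
    case (Suc m)
    let ?A = "\<lambda>J. {z \<in> space M. (\<forall>j<m. z \<notin> pivot_pair a j) \<and> (\<forall>j\<in>J. z \<in> pivot_pair a j)}"
    have meas: "?A J \<in> events" if "finite J" for J
    proof -
      have "?A J = (space M - (\<Union>j<m. pivot_pair a j)) \<inter> {z \<in> space M. \<forall>j\<in>J. z \<in> pivot_pair a j}"
        by auto
      then show ?thesis
        using sets_pivot_pairs[OF that] sets_pivot_pair by auto
    qed
    have "{z \<in> space M. (\<forall>j<Suc m. z \<notin> pivot_pair a j) \<and> (\<forall>j\<in>J. z \<in> pivot_pair a j)} =
        ?A J - ?A (insert m J)"
      by (auto simp: less_Suc_eq)
    then have "prob {z \<in> space M. (\<forall>j<Suc m. z \<notin> pivot_pair a j) \<and> (\<forall>j\<in>J. z \<in> pivot_pair a j)} =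
        prob (?A J) - prob (?A (insert m J))"
      using finite_measure_Diff[OF meas meas, of J "insert m J"] Suc.prems by auto
    also have "prob (?A J) = (1 - pivot_prob a ^ 2) ^ m * (pivot_prob a ^ 2) ^ card J"
      using Suc.prems by (intro Suc.IH) auto
    also have "prob (?A (insert m J)) = (1 - pivot_prob a ^ 2) ^ m * (pivot_prob a ^ 2) ^ card (insert m J)"
      using Suc.prems by (intro Suc.IH) auto
    also have "card (insert m J) = Suc (card J)"
      using Suc.prems by (intro card_insert_disjoint) auto
    finally show ?case by (simp add: algebra_simps)
  qed
  from this[of "{}" n] show ?thesis by simp
qed

end

subsection \<open>Bounds on the moments\<close>

text \<open>A pair \<open>(d, r)\<close> stands for the edges \<open>(x, x + d)\<close> with \<open>x \<equiv> r\<close> modulo \<open>d\<close>, which form a path.\<close>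

definition edge_classes :: "nat \<Rightarrow> (int \<times> int) set" where
  "edge_classes l = (SIGMA d:{1..int l}. {0..<d})"

lemma finite_edge_classes: "finite (edge_classes l)"
  by (simp add: edge_classes_def)

lemma card_edge_classes: "real (card (edge_classes l)) = real l * (real l + 1) / 2"
proof (induction l)
  case (Suc l)
  have "{1..int (Suc l)} = insert (int l + 1) {1..int l}" by auto
  then have "edge_classes (Suc l) = {int l + 1} \<times> {0..<int l + 1} \<union> edge_classes l"
    by (auto simp: edge_classes_def)
  moreover have "card ({int l + 1} \<times> {0..<int l + 1} \<union> edge_classes l) =
      card ({int l + 1} \<times> {0..<int l + 1}) + card (edge_classes l)"
    by (rule card_Un_disjoint) (auto simp: edge_classes_def)
  ultimately show ?case using Suc by (simp add: card_cartesian_product field_simps)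
qed (simp add: edge_classes_def)

definition cut_edges :: "nat \<Rightarrow> (int \<times> int) set" where
  "cut_edges l = {(x, y) \<in> spread_out_edges l. x < int l \<and> int l \<le> y}"

text \<open>Here \<open>r\<close> is the distance from the left endpoint to \<open>l - 1\<close>: an
  edge of length \<open>d\<close> crosses the cut exactly if \<open>0 \<le> r < d\<close>. This is
  why both moment bounds have the same exponent.\<close>

lemma bij_betw_cut_edges:
  "bij_betw (\<lambda>(d, r). (int l - 1 - r, int l - 1 - r + d)) (edge_classes l) (cut_edges l)"
  by (rule bij_betwI[where g = "\<lambda>(x, y). (y - x, int l - 1 - x)"])
    (auto simp: edge_classes_def cut_edges_def spread_out_edges_def)

lemma card_cut_edges: "card (cut_edges l) = card (edge_classes l)" "finite (cut_edges l)"
  using bij_betw_same_card[OF bij_betw_cut_edges] bij_betw_finite[OF bij_betw_cut_edges]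
    finite_edge_classes by (metis, metis)

section \<open>Infinite moments from a heavy cut\<close>

context iid_line
begin

text \<open>If all edges across the cut between \<open>l - 1\<close> and \<open>l\<close> are heavy, then none of the vertices
  \<open>1, \<dots>, 2 * l - 2\<close> is a pivot, since each would need one of these edges to be light.\<close>

lemma pivots_around_cut:
  assumes a: "0 < a" "2 * a \<le> x" and piv: "pivot l a w 0" "pivot l a w (2 * int l - 1)"
    and heavy: "\<And>i j. (i, j) \<in> cut_edges l \<Longrightarrow> x < w i j"
  shows "first_pivot l a w = 0" "second_pivot l a w = 2 * int l - 1"
proof -
  have "\<not> pivot l a w v" if v: "0 \<le> v" "v < 2 * int l - 1" "v \<noteq> 0" for v
  proof
    assume p: "pivot l a w v"
    show False
    proof (cases "v < int l")
      case True
      \<comment> \<open>The jump from \<open>v - 1\<close> to \<open>l\<close> is short enough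
        because \<open>1 \<le> v\<close>. In the other case the jump from \<open>l - 1\<close> to
        \<open>v + 1\<close> is, because \<open>v \<le> 2 * l - 2\<close>.\<close>
      then have "w v (int l) < a"
        using p[unfolded pivot_def, rule_format, of "v - 1" "int l"] v by auto
      moreover have "(v, int l) \<in> cut_edges l"
        using True v by (auto simp: cut_edges_def spread_out_edges_def)
      ultimately show False using heavy a by fastforce
    next
      case False
      then have "w (int l - 1) v < a"
        using p[unfolded pivot_def, rule_format, of "int l - 1" "v + 1"] v by auto
      moreover have "(int l - 1, v) \<in> cut_edges l"
        using False v by (auto simp: cut_edges_def spread_out_edges_def)
      ultimately show False using heavy a by fastforce
    qed
  qed
  then show "first_pivot l a w = 0" "second_pivot l a w = 2 * int l - 1"
    using first_second_pivot_eq[of 0 "2 * int l - 1" l a w] piv l by auto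
qed

lemma heavy_cut_event:
  assumes a: "0 < a" "2 * a \<le> x"
  obtains E where "E \<in> events"
    "prob E = pivot_prob a ^ 2 * measure D {x<..} ^ card (edge_classes l)"
    "\<And>z. z \<in> E \<Longrightarrow> nonneg_weights l (W z) \<Longrightarrow> x \<le> pivot_passage_time l a (W z)"
proof
  define m where "m = 2 * int l - 1"
  define K where "K = cut_edges l \<union> (pivot_edges l 0 \<union> pivot_edges l m)"
  define S where "S e = (if e \<in> cut_edges l then {x<..}
    else if e \<in> pivot_edges l 0 then pivot_range a 0 e else pivot_range a m e)" for e
  have disj: "pivot_edges l 0 \<inter> pivot_edges l m = {}"
    by (rule pivot_edges_disjoint) (use l in \<open>auto simp: m_def\<close>)
  \<comment> \<open>Edges for the pivot \<open>0\<close> end at \<open>l - 1\<close> at the latest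
    and those for \<open>m\<close> start at \<open>l\<close> at the earliest, so none crosses the
    cut.\<close>
  have disj': "cut_edges l \<inter> (pivot_edges l 0 \<union> pivot_edges l m) = {}"
    by (auto simp: cut_edges_def m_def dest!: pivot_edges_bounds)
  have K: "finite K" "K \<subseteq> spread_out_edges l"
    by (simp_all add: K_def card_cut_edges finite_pivot_edges)
      (auto simp: cut_edges_def pivot_edges_def)
  have S: "S e \<in> sets borel" for e by (simp add: S_def)
  show "pattern K S \<in> events" by (rule sets_pattern[OF K S])
  have "prob (pattern K S) = (\<Prod>e\<in>cut_edges l. measure D (S e)) *
      ((\<Prod>e\<in>pivot_edges l 0. measure D (S e)) * (\<Prod>e\<in>pivot_edges l m. measure D (S e)))"
    unfolding prob_pattern[OF K S] unfolding K_def using disj disj' card_cut_edges finite_pivot_edges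
    by (simp add: prod.union_disjoint)
  also have "(\<Prod>e\<in>cut_edges l. measure D (S e)) = (\<Prod>e\<in>cut_edges l. measure D {x<..})"
    by (rule prod.cong) (auto simp: S_def)
  also have "(\<Prod>e\<in>pivot_edges l 0. measure D (S e)) = pivot_prob a"
    unfolding pivot_prob_eq[where v = 0, symmetric] using disj'
    by (intro prod.cong) (auto simp: S_def)
  also have "(\<Prod>e\<in>pivot_edges l m. measure D (S e)) = pivot_prob a"
    unfolding pivot_prob_eq[where v = m, symmetric] using disj disj'
    by (intro prod.cong) (auto simp: S_def)
  finally show "prob (pattern K S) = pivot_prob a ^ 2 * measure D {x<..} ^ card (edge_classes l)"
    by (simp add: card_cut_edges power2_eq_square)
  fix z assume z: "z \<in> pattern K S" and "nonneg_weights l (W z)"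
  interpret nonneg_weights l "W z" by fact
  have *: "W z i j \<in> S (i, j)" if "(i, j) \<in> K" for i j
    using z that by (auto simp: pattern_def)
  have heavy: "x < W z i j" if "(i, j) \<in> cut_edges l" for i j
    using *[of i j] that by (simp add: K_def S_def)
  have "W z i j \<in> pivot_range a 0 (i, j)" if "(i, j) \<in> pivot_edges l 0" for i j
    using *[of i j] that disj' by (auto simp: K_def S_def split: if_splits)
  then have "pivot l a (W z) 0"
    unfolding pivot_iff[OF l] by blast
  moreover have "W z i j \<in> pivot_range a m (i, j)" if "(i, j) \<in> pivot_edges l m" for i j
    using *[of i j] that disj disj' by (auto simp: K_def S_def split: if_splits)
  then have "pivot l a (W z) m"
    unfolding pivot_iff[OF l] by blast
  ultimately have "pivot_passage_time l a (W z) = passage_time l (W z) 0 m"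
    unfolding pivot_passage_time_def using pivots_around_cut[OF a _ _ heavy] by (simp add: m_def)
  also have "x \<le> passage_time l (W z) 0 m"
  proof (rule passage_time_ge_cut)
    show "x \<le> W z i j" if "(i, j) \<in> spread_out_edges l" "i < int l" "int l \<le> j" for i j
      using heavy[of i j] that by (simp add: cut_edges_def)
  qed (use l in \<open>auto simp: m_def\<close>)
  finally show "x \<le> pivot_passage_time l a (W z)" .
qed

lemma moment_infinite:
  assumes L: "slowly_varying L" "\<forall>\<^sub>F x in at_top. measure D {x<..} = x powr (- \<gamma>) * L x"
    and \<gamma>: "\<gamma> * card (edge_classes l) < real k"
    and a: "0 < a" "0 < measure D {..<a}" "0 < measure D {2 * a<..}"
  shows "(\<integral>\<^sup>+ z. ennreal (pivot_passage_time l a (W z) ^ k) \<partial>M) = \<infinity>"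
proof (rule ccontr)
  let ?c = "card (edge_classes l)"
  let ?F = "\<lambda>x. measure D {x<..}"
  let ?I = "\<integral>\<^sup>+ z. ennreal (pivot_passage_time l a (W z) ^ k) \<partial>M"
  assume "?I \<noteq> \<infinity>"
  then obtain I where I: "?I = ennreal I" "0 \<le> I" by (cases ?I) auto
  have c: "0 < ?c" using card_edge_classes[of l] l by (auto intro!: Nat.gr0I)
  have "\<gamma> < real k / ?c" using \<gamma> c by (simp add: field_simps)
  then obtain \<beta> where \<beta>: "\<gamma> < \<beta>" "\<beta> < real k / ?c"
    using dense by blast
  then have "\<beta> * ?c < k" using c by (simp add: field_simps)
  then obtain x0 where x0: "2 * a \<le> x0" "0 < x0" "0 < ?F x0"
    "\<And>n. (2 powr (- \<beta>)) ^ n * ?F x0 \<le> ?F (2 ^ n * x0)"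
    using slowly_varying_tail_lower[OF L \<beta>(1), of "2 * a"] by blast
  \<comment> \<open>Markov's inequality, with the explicit event \<open>E\<close> in place of a
    level set of the passage time.\<close>
  have lower: "x ^ k * (pivot_prob a ^ 2 * ?F x ^ ?c) \<le> I" if x: "2 * a \<le> x" for x
  proof -
    obtain E where E: "E \<in> events" "prob E = pivot_prob a ^ 2 * ?F x ^ ?c"
      "\<And>z. z \<in> E \<Longrightarrow> nonneg_weights l (W z) \<Longrightarrow> x \<le> pivot_passage_time l a (W z)"
      using heavy_cut_event[OF a(1) x] by blast
    have "ennreal (x ^ k * prob E) = (\<integral>\<^sup>+ z. ennreal (x ^ k) * indicator E z \<partial>M)"
      using E x a by (simp add: nn_integral_cmult_indicator ennreal_mult emeasure_eq_measure)
    also have "\<dots> \<le> ?I"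
      by (rule nn_integral_mono_AE) (use AE_nonneg_weights in
        \<open>eventually_elim, use E x a in \<open>auto split: split_indicator intro!: ennreal_leI power_mono\<close>\<close>)
    finally show ?thesis using I E by (simp add: ennreal_le_iff)
  qed
  \<comment> \<open>Growth factor of the lower bound when \<open>x\<close> doubles; \<beta> was
    chosen to make it exceed 1.\<close>
  define q where "q = 2 ^ k * (2 powr (- \<beta>)) ^ ?c"
  have "q = 2 powr (real k - \<beta> * ?c)"
    by (simp add: q_def powr_realpow[symmetric] powr_powr powr_add[symmetric])
  then have "1 < q" using \<open>\<beta> * ?c < k\<close> by simp
  define b where "b = x0 ^ k * (pivot_prob a ^ 2 * ?F x0 ^ ?c)"
  have "0 < b" using x0 pivot_prob_pos[OF a(2,3)] by (simp add: b_def)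
  have "b * q ^ n \<le> I" for n
  proof -
    have "1 * (2 * a) \<le> 2 ^ n * x0" using x0 a by (intro mult_mono) auto
    have "b * q ^ n = (2 ^ n * x0) ^ k * (pivot_prob a ^ 2 * ((2 powr (- \<beta>)) ^ n * ?F x0) ^ ?c)"
      by (simp add: b_def q_def power_mult_distrib power_mult[symmetric] mult_ac)
    also have "\<dots> \<le> (2 ^ n * x0) ^ k * (pivot_prob a ^ 2 * ?F (2 ^ n * x0) ^ ?c)"
      using x0 by (intro mult_left_mono power_mono) auto
    also have "\<dots> \<le> I" using \<open>1 * (2 * a) \<le> 2 ^ n * x0\<close> by (intro lower) simp
    finally show ?thesis .
  qed
  moreover obtain n where "I / b < q ^ n"
    using real_arch_pow[OF \<open>1 < q\<close>] by blast
  then have "I < b * q ^ n" using \<open>0 < b\<close> by (simp add: field_simps)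
  ultimately show False by (simp add: not_less[symmetric])
qed

section \<open>Finite moments from edge-disjoint paths\<close>

definition heavy_classes :: "nat \<Rightarrow> real \<Rightarrow> 'a set" where
  "heavy_classes R t = {z \<in> space M. \<forall>(d, r)\<in>edge_classes l.
     \<exists>x\<in>{0..int R}. x mod d = r \<and> t < W z x (x + d)}"

text \<open>Union bound over the choices of one heavy edge in each class.\<close>

lemma
  shows sets_heavy_classes: "heavy_classes R t \<in> events"
    and prob_heavy_classes:
      "prob (heavy_classes R t) \<le> ((real R + 1) * measure D {t<..}) ^ card (edge_classes l)"
proof -
  let ?I = "edge_classes l"
  define \<Phi> where "\<Phi> = {f \<in> ?I \<rightarrow>\<^sub>E {0..int R}. \<forall>e\<in>?I. f e mod fst e = snd e}"
  define K where "K f = (\<lambda>e. (f e, f e + fst e)) ` ?I" for f :: "int \<times> int \<Rightarrow> int"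
  let ?P = "\<lambda>f. pattern (K f) (\<lambda>_. {t<..})"
  have fin: "finite (?I \<rightarrow>\<^sub>E {0..int R})"
    by (intro finite_PiE finite_edge_classes) auto
  then have fin': "finite \<Phi>" by (auto simp: \<Phi>_def)
  have "card \<Phi> \<le> card (?I \<rightarrow>\<^sub>E {0..int R})"
    by (rule card_mono[OF fin]) (auto simp: \<Phi>_def)
  then have card: "card \<Phi> \<le> (R + 1) ^ card ?I"
    by (simp add: card_PiE finite_edge_classes nat_add_distrib)
  have KE: "K f \<subseteq> spread_out_edges l" "finite (K f)" for f
    by (auto simp: K_def spread_out_edges_def edge_classes_def)
  \<comment> \<open>An edge determines its class through its length and the residue of its left
    endpoint. So the chosen edges are distinct and the product formula has one factor per
    class.\<close>
  have "inj_on (\<lambda>e. (f e, f e + fst e)) ?I" if "f \<in> \<Phi>" for f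
  proof (rule inj_onI)
    fix e e' assume e: "e \<in> ?I" "e' \<in> ?I" "(f e, f e + fst e) = (f e', f e' + fst e')"
    then have "f e mod fst e = snd e" "f e' mod fst e' = snd e'"
      using that by (auto simp: \<Phi>_def)
    moreover have "f e = f e'" "fst e = fst e'" using e(3) by auto
    ultimately show "e = e'" by (metis prod_eqI)
  qed
  then have "card (K f) = card ?I" if "f \<in> \<Phi>" for f
    unfolding K_def using that by (intro card_image) blast
  moreover have "prob (?P f) = (\<Prod>e\<in>K f. measure D {t<..})" for f
    by (rule prob_pattern[OF KE(2,1)]) simp
  ultimately have prob: "prob (?P f) = measure D {t<..} ^ card ?I" if "f \<in> \<Phi>" for f
    using that by simp
  have eq: "heavy_classes R t = (\<Union>f\<in>\<Phi>. ?P f)"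
  proof (intro equalityI subsetI)
    fix z assume z: "z \<in> heavy_classes R t"
    then have "\<forall>e\<in>?I. \<exists>x. x \<in> {0..int R} \<and> x mod fst e = snd e \<and> t < W z x (x + fst e)"
      by (fastforce simp: heavy_classes_def)
    then obtain g where g: "\<forall>e\<in>?I. g e \<in> {0..int R} \<and> g e mod fst e = snd e \<and> t < W z (g e) (g e + fst e)"
      by metis
    then have "restrict g ?I \<in> \<Phi>" by (auto simp: \<Phi>_def)
    moreover have "z \<in> ?P (restrict g ?I)"
      using g z by (auto simp: pattern_def K_def heavy_classes_def)
    ultimately show "z \<in> (\<Union>f\<in>\<Phi>. ?P f)" by blast
  next
    fix z assume "z \<in> (\<Union>f\<in>\<Phi>. ?P f)"
    then obtain f where f: "f \<in> \<Phi>" "z \<in> ?P f" by blast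
    have "\<exists>x\<in>{0..int R}. x mod d = r \<and> t < W z x (x + d)" if "(d, r) \<in> ?I" for d r
      using f that by (intro bexI[of _ "f (d, r)"]) (auto simp: \<Phi>_def pattern_def K_def)
    then show "z \<in> heavy_classes R t" using f(2) by (auto simp: heavy_classes_def pattern_def)
  qed
  have sets: "?P f \<in> events" for f by (rule sets_pattern) (use KE in auto)
  show "heavy_classes R t \<in> events" unfolding eq using fin' sets by auto
  have "prob (heavy_classes R t) \<le> (\<Sum>f\<in>\<Phi>. prob (?P f))"
    unfolding eq using fin' sets by (intro finite_measure_subadditive_finite) auto
  also have "\<dots> = real (card \<Phi>) * measure D {t<..} ^ card ?I"
    using prob by simp
  also have "\<dots> \<le> real ((R + 1) ^ card ?I) * measure D {t<..} ^ card ?I"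
    using card by (intro mult_right_mono) (auto simp del: of_nat_power)
  finally show "prob (heavy_classes R t) \<le> ((real R + 1) * measure D {t<..}) ^ card ?I"
    by (simp add: power_mult_distrib add_ac)
qed

lemma pivot_passage_time_bounds:
  assumes z: "z \<in> space M" "nonneg_weights l (W z)" and a: "0 \<le> a" and t: "0 \<le> t"
    and j: "j < n" "z \<in> pivot_pair a j" and light: "z \<notin> heavy_classes (4 * l * n) t"
  shows "0 \<le> pivot_passage_time l a (W z)"
    "pivot_passage_time l a (W z) \<le> 2 * a + real (4 * l * n) * t"
proof -
  interpret nonneg_weights l "W z" by fact
  let ?u = "4 * int l * int j" and ?v = "4 * int l * int j + 2 * int l"
  have "4 * int l * (int j + 1) \<le> 4 * int l * int n"
    using j by (intro mult_left_mono) auto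
  then have v: "?v \<le> int (4 * l * n)" by (simp add: algebra_simps)
  have "0 \<le> ?u" "?u < ?v" "pivot l a (W z) ?u" "pivot l a (W z) ?v"
    using j l by (auto simp: pivot_pair_def)
  note p = first_second_pivot[OF this]
  show "0 \<le> pivot_passage_time l a (W z)"
    unfolding pivot_passage_time_def using p l by (intro passage_time_nonneg) auto
  \<comment> \<open>Outside \<open>heavy_classes\<close> some class has only light edges in the
    window, which gives a cheap route between the pivots.\<close>
  obtain d r where dr: "(d, r) \<in> edge_classes l"
    "\<forall>x\<in>{0..int (4 * l * n)}. x mod d = r \<longrightarrow> W z x (x + d) \<le> t"
    using light z by (auto simp: heavy_classes_def not_less)
  show "pivot_passage_time l a (W z) \<le> 2 * a + real (4 * l * n) * t"
    unfolding pivot_passage_time_def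
    by (rule passage_time_between_pivots_le[OF p(1-4) _ a l _ _ _ _ t, of "4 * l * n" d r])
      (use dr p v in \<open>auto simp: edge_classes_def\<close>)
qed

text \<open>At level \<open>2 ^ i\<close> the window has length of order \<open>i\<close>. Missing a
  pivot pair is then exponentially unlikely in \<open>i\<close>, while the union bound loses only a
  power of \<open>i\<close>.\<close>

lemma moment_finite:
  assumes F: "0 < C" "\<And>t. 0 < t \<Longrightarrow> measure D {t<..} \<le> C * t powr (- \<beta>)"
    and \<beta>: "real k < \<beta> * card (edge_classes l)"
    and a: "0 < a" "0 < measure D {..<a}" "0 < measure D {2 * a<..}"
  shows "(\<integral>\<^sup>+ z. ennreal (pivot_passage_time l a (W z) ^ k) \<partial>M) < \<infinity>"
proof -
  let ?c = "card (edge_classes l)"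
  let ?T = "\<lambda>z. pivot_passage_time l a (W z)"
  have "0 \<le> \<beta>"
  proof (rule ccontr)
    assume "\<not> 0 \<le> \<beta>"
    then have "\<beta> * ?c \<le> 0" by (intro mult_nonpos_nonneg) auto
    then show False using \<beta> by linarith
  qed
  define p where "p = 1 - pivot_prob a ^ 2"
  have "p < 1" using pivot_prob_pos[OF a(2,3)] by (simp add: p_def)
  \<comment> \<open>With \<open>i * m\<close> pairs, the probability of finding none beats the
    weight \<open>2 ^ (i * k)\<close> and leaves a spare factor \<open>(1 / 2) ^ i\<close>.\<close>
  then obtain m where m: "p ^ m < (1 / 2) ^ Suc k"
    using real_arch_pow_inv[of "(1 / 2) ^ Suc k" p] by auto
  have "p = prob {z \<in> space M. \<forall>j<1. z \<notin> pivot_pair a j}"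
    unfolding prob_no_pivot_pair p_def by simp
  then have p: "0 \<le> p" by simp
  define R where "R i = 4 * l * (i * m)" for i
  \<comment> \<open>Chosen so that \<open>R i * t i \<le> 2 * a * 2 ^ i\<close>; with the light
    edges at both ends the total is at most \<open>4 * a * 2 ^ i\<close>. Adding 1 avoids division
    by zero at \<open>i = 0\<close>.\<close>
  define t where "t i = 2 * a * 2 ^ i / (real (R i) + 1)" for i
  define E where "E i = {z \<in> space M. \<forall>j<i * m. z \<notin> pivot_pair a j} \<union> heavy_classes (R i) (t i)" for i
  have t: "0 < t i" for i using a by (simp add: t_def add_nonneg_pos)
  have no_pair: "{z \<in> space M. \<forall>j<n. z \<notin> pivot_pair a j} \<in> events" for n
  proof -
    have "{z \<in> space M. \<forall>j<n. z \<notin> pivot_pair a j} = space M - (\<Union>j<n. pivot_pair a j)" by auto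
    then show ?thesis using sets_pivot_pair by auto
  qed
  show ?thesis
  proof (rule moment_finite_dyadic[where E = E and b = "4 * a"])
    show "E i \<in> events" for i
      unfolding E_def by (rule sets.Un[OF no_pair sets_heavy_classes])
    show "AE z in M. \<forall>i. 4 * a * 2 ^ i < \<bar>?T z\<bar> \<longrightarrow> z \<in> E i"
      using AE_nonneg_weights AE_space
    proof eventually_elim
      case (elim z)
      have "\<bar>?T z\<bar> \<le> 4 * a * 2 ^ i" if z: "z \<notin> E i" for i
      proof -
        obtain j where j: "j < i * m" "z \<in> pivot_pair a j" and light: "z \<notin> heavy_classes (R i) (t i)"
          using z elim by (auto simp: E_def)
        note b = pivot_passage_time_bounds[OF elim(2,1) less_imp_le[OF a(1)] less_imp_le[OF t] j
          light[unfolded R_def], folded R_def]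
        have "real (R i) * t i \<le> (real (R i) + 1) * t i"
          using t[of i] by (intro mult_right_mono) auto
        also have "\<dots> = 2 * a * 2 ^ i" by (simp add: t_def add_nonneg_eq_0_iff)
        moreover have "2 * a * 1 \<le> 2 * a * 2 ^ i" using a by (intro mult_left_mono) auto
        ultimately show ?thesis using b by linarith
      qed
      then show ?case by (meson not_less)
    qed
    \<comment> \<open>\<open>A * i + 1\<close> dominates \<open>R i + 1\<close>, and
      \<open>q < 1\<close> expresses the assumption relating \<open>k\<close> and \<beta>.\<close>
    define A where "A = 4 * real l * real m + 1"
    define q where "q = 2 ^ k * 2 powr (- \<beta> * ?c)"
    define B where "B = (C * (2 * a) powr (- \<beta>)) ^ ?c"
    have "q = 2 powr (real k - \<beta> * ?c)"
      by (simp add: q_def powr_diff powr_minus_divide powr_realpow)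
    moreover have "2 powr (real k - \<beta> * ?c) < 2 powr 0" using \<beta> by (intro powr_less_mono) auto
    ultimately have q: "0 < q" "q < 1" by simp_all
    \<comment> \<open>In the exponent \<open>1 + \<beta>\<close>, the 1 comes from the
      \<open>R i + 1\<close> choices in each class and the \<beta> from the denominator of
      \<open>t i\<close>.\<close>
    have bound: "2 ^ (i * k) * prob (E i) \<le> (1 / 2) ^ i + B * ((A * real i + 1) powr ((1 + \<beta>) * ?c) * q ^ i)"
      for i
    proof -
      have "prob (E i) \<le> p ^ (i * m) + ((real (R i) + 1) * measure D {t i<..}) ^ ?c"
        using measure_Un_le[OF no_pair[of "i * m"] sets_heavy_classes[of "R i" "t i"]]
          prob_heavy_classes[of "R i" "t i"] prob_no_pivot_pair[of "i * m" a]
        by (simp add: E_def p_def)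
      moreover have "p ^ (i * m) \<le> ((1 / 2) ^ Suc k) ^ i"
        using m p by (subst mult.commute, subst power_mult) (intro power_mono, auto)
      moreover have "((real (R i) + 1) * measure D {t i<..}) ^ ?c \<le>
          B * ((A * real i + 1) powr ((1 + \<beta>) * ?c) * (2 powr (- \<beta> * ?c)) ^ i)"
      proof -
        define y where "y = real (R i) + 1"
        have y: "0 < y" "y \<le> A * real i + 1"
          by (simp add: y_def add_nonneg_pos) (simp add: y_def R_def A_def algebra_simps)
        have "t i powr (- \<beta>) = (2 * a) powr (- \<beta>) * (2 powr (- \<beta>)) ^ i * y powr \<beta>"
        proof -
          have "t i powr (- \<beta>) = (2 * a * 2 ^ i) powr (- \<beta>) / y powr (- \<beta>)"
            using a y by (simp add: t_def y_def[symmetric] powr_divide)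
          also have "(2 * a * 2 ^ i) powr (- \<beta>) = (2 * a) powr (- \<beta>) * (2 ^ i) powr (- \<beta>)"
            by (rule powr_mult)
          also have "(2 ^ i) powr (- \<beta>) = (2 powr (- \<beta>)) ^ i"
            using powr_powr[of 2 "- \<beta>" "real i"] powr_powr[of 2 "real i" "- \<beta>"]
            by (simp add: powr_realpow mult.commute)
          finally show ?thesis by (simp add: powr_minus_divide)
        qed
        then have "y * measure D {t i<..} \<le>
            y * (C * ((2 * a) powr (- \<beta>) * (2 powr (- \<beta>)) ^ i * y powr \<beta>))"
          using F(2)[OF t, of i] y by (intro mult_left_mono) auto
        also have "\<dots> = C * (2 * a) powr (- \<beta>) * (y powr (1 + \<beta>) * (2 powr (- \<beta>)) ^ i)"
          using y by (simp add: powr_add mult_ac)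
        also have "\<dots> \<le> C * (2 * a) powr (- \<beta>) * ((A * real i + 1) powr (1 + \<beta>) * (2 powr (- \<beta>)) ^ i)"
          using y F(1) \<open>0 \<le> \<beta>\<close> by (intro mult_left_mono mult_right_mono powr_mono2) auto
        finally have "(y * measure D {t i<..}) ^ ?c \<le>
            (C * (2 * a) powr (- \<beta>) * ((A * real i + 1) powr (1 + \<beta>) * (2 powr (- \<beta>)) ^ i)) ^ ?c"
          using y by (intro power_mono) auto
        also have "\<dots> = B * (((A * real i + 1) powr (1 + \<beta>)) ^ ?c * ((2 powr (- \<beta>)) ^ ?c) ^ i)"
          by (simp add: B_def power_mult_distrib power_mult[symmetric] mult.commute)
        finally show ?thesis
          using y by (simp add: y_def powr_power mult.commute)
      qed
      ultimately have "prob (E i) \<le> ((1 / 2) ^ Suc k) ^ i +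
          B * ((A * real i + 1) powr ((1 + \<beta>) * ?c) * (2 powr (- \<beta> * ?c)) ^ i)" by linarith
      then have "2 ^ (i * k) * prob (E i) \<le> 2 ^ (i * k) * (((1 / 2) ^ Suc k) ^ i +
          B * ((A * real i + 1) powr ((1 + \<beta>) * ?c) * (2 powr (- \<beta> * ?c)) ^ i))"
        by (intro mult_left_mono) auto
      also have "\<dots> = (1 / 2) ^ i + B * ((A * real i + 1) powr ((1 + \<beta>) * ?c) * q ^ i)"
      proof -
        have "(2::real) ^ (i * k) * ((1 / 2) ^ Suc k) ^ i = (2 ^ k * (1 / 2) ^ Suc k) ^ i"
          by (simp only: power_mult_distrib power_mult[symmetric] mult.commute)
        also have "(2::real) ^ k * (1 / 2) ^ Suc k = 1 / 2"
          by (simp add: power_one_over)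
        finally show ?thesis
          by (simp add: q_def distrib_left power_mult_distrib power_mult[symmetric] mult_ac)
      qed
      finally show ?thesis .
    qed
    have "summable (\<lambda>i. (1 / 2) ^ i + B * ((A * real i + 1) powr ((1 + \<beta>) * ?c) * q ^ i))"
      using q by (intro summable_add summable_mult summable_powr_times_geometric)
        (auto simp: A_def add_nonneg_pos)
    then show "summable (\<lambda>i. 2 ^ (i * k) * prob (E i))"
      by (rule summable_comparison_test'[where N = 0]) (use bound in simp)
  qed (use a in simp)
qed

end

section \<open>Conclusion for the law of the weights\<close>

theorem proposition2p5:
  fixes l k :: nat and a :: real
    and N :: "'b measure" and \<omega> :: "'b \<Rightarrow> real"
    and M :: "'a measure" and W :: "'a \<Rightarrow> int \<Rightarrow> int \<Rightarrow> real"
  assumes l: "l \<ge> 2" and k: "k \<ge> 1"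
    and N: "prob_space N"
    and \<omega>_measurable: "\<omega> \<in> borel_measurable N"
    and \<omega>_nonneg: "AE z in N. 0 \<le> \<omega> z"
    and M: "prob_space M"
    and indep: "prob_space.indep_vars M (\<lambda>_. borel) (\<lambda>(x, y) z. W z x y) (spread_out_edges l)"
    and law: "\<And>x y. (x, y) \<in> spread_out_edges l \<Longrightarrow>
                distr M borel (\<lambda>z. W z x y) = distr N borel \<omega>"
    and sym: "\<And>x y z. (x, y) \<in> spread_out_edges l \<Longrightarrow> z \<in> space M \<Longrightarrow> W z y x = W z x y"
    and a: "a > 0" "\<P>(z in N. \<omega> z > 2 * a) > 0" "\<P>(z in N. \<omega> z < a) > 0"
  defines "lc \<equiv> real l * (real l + 1) / 2"
  shows "(\<forall>\<gamma>. heavy_tail N \<omega> \<gamma> \<and> 0 < \<gamma> \<and> \<gamma> < real k / lc \<longrightarrow>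
            (\<integral>\<^sup>+ z. ennreal (pivot_passage_time l a (W z) ^ k) \<partial>M) = \<infinity>) \<and>
         ((\<exists>\<gamma>. heavy_tail N \<omega> \<gamma> \<and> \<gamma> > real k / lc) \<or>
            (\<integral>\<^sup>+ z. ennreal (\<omega> z ^ k) \<partial>N) < \<infinity> \<longrightarrow>
            (\<integral>\<^sup>+ z. ennreal (pivot_passage_time l a (W z) ^ k) \<partial>M) < \<infinity>)"
proof -
  interpret prob_space M by (rule M)
  interpret N: prob_space N by (rule N)
  define D where "D = distr N borel \<omega>"
  have "AE t in D. 0 \<le> t"
    unfolding D_def using \<omega>_measurable \<omega>_nonneg by (subst AE_distr_iff) auto
  then interpret iid_line M l W D
    using indep law sym l by unfold_locales (auto simp: D_def)
  have F: "measure D {x<..} = \<P>(z in N. \<omega> z > x)" "measure D {..<x} = \<P>(z in N. \<omega> z < x)" for x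
    unfolding D_def using \<omega>_measurable
    by (auto simp: measure_distr vimage_def Int_def conj_commute intro!: arg_cong[where f = N.prob])
  note a' = a(1) a(3,2)[folded F]
  have lc: "lc = real (card (edge_classes l))" "3 \<le> lc"
  proof -
    show "lc = real (card (edge_classes l))" by (simp add: lc_def card_edge_classes)
    have "2 * (2 + 1) \<le> real l * (real l + 1)" using l by (intro mult_mono) auto
    then show "3 \<le> lc" by (simp add: lc_def)
  qed
  show ?thesis
  proof (intro conjI allI impI; (elim conjE)?)
    fix \<gamma> assume \<gamma>: "heavy_tail N \<omega> \<gamma>" "\<gamma> < real k / lc"
    then obtain L where L: "slowly_varying L"
      "\<forall>\<^sub>F x in at_top. measure D {x<..} = x powr (- \<gamma>) * L x"
      unfolding heavy_tail_def F by blast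
    show "(\<integral>\<^sup>+ z. ennreal (pivot_passage_time l a (W z) ^ k) \<partial>M) = \<infinity>"
      by (rule moment_infinite[OF L _ a']) (use \<gamma> lc in \<open>simp add: field_simps\<close>)
  next
    assume "(\<exists>\<gamma>. heavy_tail N \<omega> \<gamma> \<and> \<gamma> > real k / lc) \<or> (\<integral>\<^sup>+ z. ennreal (\<omega> z ^ k) \<partial>N) < \<infinity>"
    then have "\<exists>\<beta> C. real k < \<beta> * lc \<and> 0 < C \<and> (\<forall>t>0. measure D {t<..} \<le> C * t powr (- \<beta>))"
    proof
      assume "\<exists>\<gamma>. heavy_tail N \<omega> \<gamma> \<and> \<gamma> > real k / lc"
      then obtain \<gamma> L where \<gamma>: "real k / lc < \<gamma>" and L: "slowly_varying L"
        "\<forall>\<^sub>F x in at_top. measure D {x<..} = x powr (- \<gamma>) * L x"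
        unfolding heavy_tail_def F by blast
      \<comment> \<open>The strict inequality leaves room to lower \<gamma> slightly and absorb the
        slowly varying factor.\<close>
      obtain \<beta> where \<beta>: "real k / lc < \<beta>" "\<beta> < \<gamma>"
        using dense[OF \<gamma>] by blast
      moreover have "0 < real k / lc" using k lc by simp
      ultimately have "0 < \<beta>" by linarith
      have "antimono (\<lambda>x. measure D {x<..})"
        by (intro antimonoI D.finite_measure_mono) auto
      then have "\<exists>C>0. \<forall>t>0. measure D {t<..} \<le> C * t powr (- \<beta>)"
        by (rule slowly_varying_tail_upper[OF L \<open>0 < \<beta>\<close> \<beta>(2)]) (rule D.prob_le_1)
      moreover have "real k < \<beta> * lc" using \<beta>(1) lc by (simp add: pos_divide_less_eq)
      ultimately show ?thesis by blast
    next
      assume "(\<integral>\<^sup>+ z. ennreal (\<omega> z ^ k) \<partial>N) < \<infinity>"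
      \<comment> \<open>The \<open>k\<close>-th moment gives tail exponent \<open>k\<close>, and
        \<open>k < k * lc\<close> because \<open>lc\<close> exceeds 1.\<close>
      moreover have "real k * 1 < real k * lc" using k lc by (intro mult_strict_left_mono) auto
      ultimately show ?thesis
        using moment_tail_upper[OF N \<omega>_measurable, of k] unfolding F by auto
    qed
    then show "(\<integral>\<^sup>+ z. ennreal (pivot_passage_time l a (W z) ^ k) \<partial>M) < \<infinity>"
      using moment_finite[OF _ _ _ a'] lc by blast
  qed
qed

end
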